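(* Consider the Engel group modelled on $\mathbb R^4$ as in the context, and $W=\{p\in\mathbb R^4:p_2=0\}$. Let $$C:=\left\{x\in\mathbb R^4: x_2>0,\ x_4>0,\ x_2>\frac{x_3^2}{2x_4}\right\}.$$ For every $a>0$, when $C$ is represented as intrinsic upper graph in the horizontal direction $Y=aX_1+X_2$, i.e. $C=\{w\cdot\exp(tY):w\in W,\ t>T(w)\}$ with $T:W\to\mathbb R$, the function $T$ is not Lipschitz (with respect to the Euclidean distance on $W\cong\mathbb R^3$).
   Context: The Engel group is $\mathbb R^4$ with the group law for which the vector fields $X_1=\partial_1$, $X_2=\partial_2+x_1\partial_3+\frac{x_1^2}{2}\partial_4$, $X_3=\partial_3+x_1\partial_4$, $X_4=\partial_4$ are left-invariant and the identity is $0$. The flow of $Y=aX_1+X_2$ is $$p\cdot\exp(tY)=\left(p_1+at,\;p_2+t,\;p_3+p_1t+\tfrac a2t^2,\;p_4+\tfrac{p_1^2}{2}t+\tfrac{ap_1}{2}t^2+\tfrac{a^2}{6}t^3\right),$$ and every $q\in\mathbb R^4$ can be written uniquely as $q=w\cdot\exp(tY)$ with $w\in W$, $t\in\mathbb R$. *)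

theory Defs
  imports "HOL-Analysis.Analysis"
begin

lemma vector_4 [simp]:
  "(vector [x,y,z,w] :: ('a::zero)^4) $ 1 = x"
  "(vector [x,y,z,w] :: ('a::zero)^4) $ 2 = y"
  "(vector [x,y,z,w] :: ('a::zero)^4) $ 3 = z"
  "(vector [x,y,z,w] :: ('a::zero)^4) $ 4 = w"
  unfolding vector_def by simp_all

definition X1 :: "real^4 \<Rightarrow> real^4"
  where "X1 p = vector [1, 0, 0, 0]"

definition X2 :: "real^4 \<Rightarrow> real^4"
  where "X2 p = vector [0, 1, p $ 1, (p $ 1)\<^sup>2 / 2]"

definition X3 :: "real^4 \<Rightarrow> real^4"
  where "X3 p = vector [0, 0, 1, p $ 1]"

definition X4 :: "real^4 \<Rightarrow> real^4"
  where "X4 p = vector [0, 0, 0, 1]"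

definition left_invariant ::
    "(real^4 \<Rightarrow> real^4 \<Rightarrow> real^4) \<Rightarrow> (real^4 \<Rightarrow> real^4) \<Rightarrow> bool"
  where "left_invariant m X \<longleftrightarrow>
    (\<forall>p q. \<exists>D. (m p has_derivative D) (at q) \<and> D (X q) = X (m p q))"

(* The paper describes the group law only through its identity and left-invariant fields;
   engel_mult_unique shows that this explicit law is the only one fitting that description. *)
definition engel_mult :: "real^4 \<Rightarrow> real^4 \<Rightarrow> real^4"  (infixl "\<cdot>\<^sub>E" 70)
  where "p \<cdot>\<^sub>E q = vector
    [p $ 1 + q $ 1,
     p $ 2 + q $ 2,
     p $ 3 + q $ 3 + p $ 1 * q $ 2,
     p $ 4 + q $ 4 + (p $ 1)\<^sup>2 / 2 * q $ 2 + p $ 1 * q $ 3]"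

definition engel_inv :: "real^4 \<Rightarrow> real^4"
  where "engel_inv p = vector
    [- (p $ 1), - (p $ 2), p $ 1 * p $ 2 - p $ 3,
     p $ 1 * p $ 3 - (p $ 1)\<^sup>2 / 2 * p $ 2 - p $ 4]"

lemma engel_group: "group engel_mult 0 engel_inv"
  by unfold_locales
    (simp_all add: engel_mult_def engel_inv_def vec_eq_iff forall_4 field_simps power2_eq_square)

definition integral_curve ::
    "(real^4 \<Rightarrow> real^4) \<Rightarrow> (real \<Rightarrow> real^4) \<Rightarrow> bool"
  where "integral_curve V \<gamma> \<longleftrightarrow> (\<forall>s. (\<gamma> has_vector_derivative V (\<gamma> s)) (at s))"

(* Meaningful for left-invariant V, which are complete with unique integral curves. *)
definition engel_exp :: "(real^4 \<Rightarrow> real^4) \<Rightarrow> real^4"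
  where "engel_exp V = (THE \<gamma>. integral_curve V \<gamma> \<and> \<gamma> 0 = 0) 1"

definition horizontal :: "real \<Rightarrow> real^4 \<Rightarrow> real^4"
  where "horizontal a p = a *\<^sub>R X1 p + X2 p"

definition W :: "(real^4) set"
  where "W = {p. p $ 2 = 0}"

(* Only the values of T on W matter. *)
definition intrinsic_upper_graph ::
    "(real^4 \<Rightarrow> real^4) \<Rightarrow> (real^4 \<Rightarrow> real) \<Rightarrow> (real^4) set"
  where "intrinsic_upper_graph Y T =
    {w \<cdot>\<^sub>E engel_exp (\<lambda>p. t *\<^sub>R Y p) | w t. w \<in> W \<and> t > T w}"

definition C :: "(real^4) set"
  where "C = {x. x $ 2 > 0 \<and> x $ 4 > 0 \<and> x $ 2 > (x $ 3)\<^sup>2 / (2 * x $ 4)}"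


lemma left_invariant_X:
  "left_invariant engel_mult X1" "left_invariant engel_mult X2"
  "left_invariant engel_mult X3" "left_invariant engel_mult X4"
proof -
  have D: "(engel_mult p has_derivative
      (\<lambda>v. vector [v $ 1, v $ 2, v $ 3 + p $ 1 * v $ 2,
         v $ 4 + (p $ 1)\<^sup>2 / 2 * v $ 2 + p $ 1 * v $ 3])) (at q)" for p q
  proof -
    let ?f = "\<lambda>v::real^4. vector [v $ 1, v $ 2, v $ 3 + p $ 1 * v $ 2,
         v $ 4 + (p $ 1)\<^sup>2 / 2 * v $ 2 + p $ 1 * v $ 3] :: real^4"
    have "linear ?f"
      by (rule linearI) (simp_all add: vec_eq_iff forall_4 algebra_simps)
    then have "(?f has_derivative ?f) (at q)"
      by (simp add: linear_imp_has_derivative)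
    then have "((\<lambda>v. p + ?f v) has_derivative ?f) (at q)"
      by (auto intro!: derivative_eq_intros)
    moreover have "(\<lambda>v. p + ?f v) = engel_mult p"
      by (simp add: fun_eq_iff engel_mult_def vec_eq_iff forall_4)
    ultimately show ?thesis by simp
  qed
  show "left_invariant engel_mult X1" "left_invariant engel_mult X2"
    "left_invariant engel_mult X3" "left_invariant engel_mult X4"
    unfolding left_invariant_def
    by (intro allI exI conjI, rule D,
        simp add: X1_def X2_def X3_def X4_def engel_mult_def vec_eq_iff forall_4
          power2_eq_square field_simps)+
qed

lemma engel_mult_unique:
  assumes inv: "left_invariant m X1" "left_invariant m X2"
      "left_invariant m X3" "left_invariant m X4"
    and neutral: "\<And>p. m p 0 = p"
  shows "m = engel_mult"
proof (intro ext)
  fix p q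
  define F where "F = m p"
  define D where "D x = frechet_derivative F (at x)" for x
  have *: "(F has_derivative D x) (at x) \<and> D x (X x) = X (F x)"
    if "left_invariant m X" for x X
    using that unfolding left_invariant_def F_def D_def
    by (metis frechet_derivative_at)
  have FD: "(F has_derivative D x) (at x)" for x
    using *[OF inv(1)] by blast
  have FX: "D x (X1 x) = X1 (F x)" "D x (X2 x) = X2 (F x)"
      "D x (X3 x) = X3 (F x)" "D x (X4 x) = X4 (F x)" for x
    using * inv by blast+
  have lin: "linear (D x)" for x
    using FD has_derivative_linear by blast
  have Dv: "D x v = v $ 1 *\<^sub>R X1 (F x)
      + (v $ 2) *\<^sub>R X2 (F x) + (v $ 3 - x $ 1 * v $ 2) *\<^sub>R X3 (F x)
      + (v $ 4 - x $ 1 * v $ 3 + (x $ 1)\<^sup>2 / 2 * v $ 2) *\<^sub>R X4 (F x)" for x v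
  proof -
    have "v = v $ 1 *\<^sub>R X1 x
      + (v $ 2) *\<^sub>R X2 x + (v $ 3 - x $ 1 * v $ 2) *\<^sub>R X3 x
      + (v $ 4 - x $ 1 * v $ 3 + (x $ 1)\<^sup>2 / 2 * v $ 2) *\<^sub>R X4 x"
      by (simp add: vec_eq_iff forall_4 X1_def X2_def X3_def X4_def
          power2_eq_square field_simps)
    then have "D x v = D x (v $ 1 *\<^sub>R X1 x
      + (v $ 2) *\<^sub>R X2 x + (v $ 3 - x $ 1 * v $ 2) *\<^sub>R X3 x
      + (v $ 4 - x $ 1 * v $ 3 + (x $ 1)\<^sup>2 / 2 * v $ 2) *\<^sub>R X4 x)"
      by simp
    also have "\<dots> = v $ 1 *\<^sub>R X1 (F x)
      + (v $ 2) *\<^sub>R X2 (F x) + (v $ 3 - x $ 1 * v $ 2) *\<^sub>R X3 (F x)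
      + (v $ 4 - x $ 1 * v $ 3 + (x $ 1)\<^sup>2 / 2 * v $ 2) *\<^sub>R X4 (F x)"
      by (simp only: linear_add[OF lin] linear_scale[OF lin] FX)
    finally show ?thesis .
  qed
  have comp: "((\<lambda>x. F x $ i) has_derivative (\<lambda>v. D x v $ i)) (at x)" for i x
    using bounded_linear.has_derivative[OF bounded_linear_vec_nth FD] .
  have const: "g x = g 0" if "\<And>x. (g has_derivative (\<lambda>v. 0)) (at x)"
    for g :: "real^4 \<Rightarrow> real" and x
    by (rule has_derivative_zero_unique[where s=UNIV]) (use that in auto)
  have F0: "F 0 = p"
    using neutral by (simp add: F_def)
  have coord: "((\<lambda>x::real^4. x $ i) has_derivative (\<lambda>v. v $ i)) (at x)" for i x
    by (rule bounded_linear_imp_has_derivative[OF bounded_linear_vec_nth])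
  note D_simps = Dv X1_def X2_def X3_def X4_def
  have F1: "F x $ 1 = p $ 1 + x $ 1" for x
  proof -
    have "((\<lambda>x. F x $ 1 - x $ 1) has_derivative (\<lambda>v. 0)) (at x)" for x
      by (rule derivative_eq_intros comp coord refl)+
         (simp add: D_simps)
    from const[OF this, of x] show ?thesis by (simp add: F0)
  qed
  have F2: "F x $ 2 = p $ 2 + x $ 2" for x
  proof -
    have "((\<lambda>x. F x $ 2 - x $ 2) has_derivative (\<lambda>v. 0)) (at x)" for x
      by (rule derivative_eq_intros comp coord refl)+
         (simp add: D_simps)
    from const[OF this, of x] show ?thesis by (simp add: F0)
  qed
  have F3: "F x $ 3 = p $ 3 + x $ 3 + p $ 1 * x $ 2" for x
  proof -
    have "((\<lambda>x. F x $ 3 - (x $ 3 + p $ 1 * x $ 2)) has_derivative (\<lambda>v. 0)) (at x)" for x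
      by (rule derivative_eq_intros comp coord refl)+
         (simp add: D_simps F1 algebra_simps)
    from const[OF this, of x] show ?thesis by (simp add: F0)
  qed
  have F4: "F x $ 4 = p $ 4 + x $ 4 + (p $ 1)\<^sup>2 / 2 * x $ 2 + p $ 1 * x $ 3" for x
  proof -
    have "((\<lambda>x. F x $ 4 - (x $ 4 + (p $ 1)\<^sup>2 / 2 * x $ 2 + p $ 1 * x $ 3))
        has_derivative (\<lambda>v. 0)) (at x)" for x
      by (rule derivative_eq_intros comp coord refl)+
         (simp add: D_simps F1 fun_eq_iff field_simps power2_eq_square)
    from const[OF this, of x] show ?thesis by (simp add: F0)
  qed
  show "m p q = p \<cdot>\<^sub>E q"
    using F1 F2 F3 F4 by (simp add: engel_mult_def vec_eq_iff forall_4 F_def)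
qed

lemma engel_exp_horizontal:
  "engel_exp (\<lambda>p. t *\<^sub>R horizontal a p) =
    vector [a * t, t, a / 2 * t\<^sup>2, a\<^sup>2 / 6 * t ^ 3]"
proof -
  define V where "V = (\<lambda>p. t *\<^sub>R horizontal a p)"
  define c where "c s = (vector [a * (t * s), t * s, a / 2 * (t * s)\<^sup>2, a\<^sup>2 / 6 * (t * s) ^ 3]
      :: real^4)" for s
  have V: "V p = vector [t * a, t, t * p $ 1, t * ((p $ 1)\<^sup>2 / 2)]" for p
    by (simp add: V_def horizontal_def X1_def X2_def vec_eq_iff forall_4)
  have curve: "integral_curve V \<gamma> \<longleftrightarrow>
      (\<forall>i s. ((\<lambda>s. \<gamma> s $ i) has_real_derivative V (\<gamma> s) $ i) (at s))" for \<gamma>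
    unfolding integral_curve_def has_vector_derivative_def has_field_derivative_def
    by (subst has_derivative_componentwise_within)
       (auto simp: Basis_vec_def inner_axis mult_commute_abs)
  have "integral_curve V c"
    unfolding curve forall_4 V c_def vector_4
    by (auto intro!: derivative_eq_intros simp: field_simps power2_eq_square power3_eq_cube)
  moreover have "c 0 = 0"
    by (simp add: c_def vec_eq_iff forall_4)
  moreover have "\<gamma> = c" if "integral_curve V \<gamma>" "\<gamma> 0 = 0" for \<gamma>
  proof
    fix s
    have d: "((\<lambda>s. \<gamma> s $ i) has_real_derivative V (\<gamma> s) $ i) (at s)" for i s
      using that curve by blast
    have const: "g s = g 0" if "\<And>s. (g has_real_derivative 0) (at s)" for g s
      using DERIV_isconst_all that by blast
    have 1: "\<gamma> s $ 1 = a * (t * s)" for s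
    proof -
      have "((\<lambda>s. \<gamma> s $ 1 - a * (t * s)) has_real_derivative 0) (at s)" for s
        by (rule derivative_eq_intros d refl)+ (simp add: V)
      from const[OF this, of s] show ?thesis using that by simp
    qed
    have 2: "\<gamma> s $ 2 = t * s" for s
    proof -
      have "((\<lambda>s. \<gamma> s $ 2 - t * s) has_real_derivative 0) (at s)" for s
        by (rule derivative_eq_intros d refl)+ (simp add: V)
      from const[OF this, of s] show ?thesis using that by simp
    qed
    have 3: "\<gamma> s $ 3 = a / 2 * (t * s)\<^sup>2" for s
    proof -
      have "((\<lambda>s. \<gamma> s $ 3 - a / 2 * (t * s)\<^sup>2) has_real_derivative 0) (at s)" for s
        by (rule derivative_eq_intros d refl)+ (simp add: V 1)
      from const[OF this, of s] show ?thesis using that by simp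
    qed
    have 4: "\<gamma> s $ 4 = a\<^sup>2 / 6 * (t * s) ^ 3" for s
    proof -
      have "((\<lambda>s. \<gamma> s $ 4 - a\<^sup>2 / 6 * (t * s) ^ 3) has_real_derivative 0) (at s)" for s
        by (rule derivative_eq_intros d refl)+ (simp add: V 1 field_simps power2_eq_square)
      from const[OF this, of s] show ?thesis using that by simp
    qed
    show "\<gamma> s = c s"
      by (simp add: c_def vec_eq_iff forall_4 1 2 3 4)
  qed
  ultimately have "(THE \<gamma>. integral_curve V \<gamma> \<and> \<gamma> 0 = 0) = c"
    by blast
  then show ?thesis
    by (simp add: engel_exp_def c_def flip: V_def)
qed

lemma flow_formula:
  "p \<cdot>\<^sub>E engel_exp (\<lambda>p. t *\<^sub>R horizontal a p) = vector
    [p $ 1 + a * t,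
     p $ 2 + t,
     p $ 3 + p $ 1 * t + a / 2 * t\<^sup>2,
     p $ 4 + (p $ 1)\<^sup>2 / 2 * t + a * p $ 1 / 2 * t\<^sup>2 + a\<^sup>2 / 6 * t ^ 3]"
  by (simp add: engel_exp_horizontal engel_mult_def vec_eq_iff forall_4)

end

theory Submission
  imports Defs "HOL-Real_Asymp.Real_Asymp"
begin

text \<open>
  Along the flow line through \<open>w = (x, 0, y, z)\<close> the quantity \<open>\<phi> = q\<^sub>4 - q\<^sub>3\<^sup>2 / (2 q\<^sub>2)\<close>
  satisfies \<open>2 t \<phi>(t) = a\<^sup>2 t\<^sup>4 / 12 - a y t\<^sup>2 + 2 (z - x y) t - y\<^sup>2\<close>, and its derivative is
  the half-square \<open>(q\<^sub>3' - q\<^sub>3 / t)\<^sup>2 / 2\<close>. Hence each flow line meets \<open>C\<close> in an open upper half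
  line, which gives the existence of \<open>T\<close>. On the axis \<open>x = y = 0\<close>, \<open>z < 0\<close>, one finds
  \<open>a\<^sup>2 T\<^sup>3 = - 24 z\<close>, so \<open>T\<close> behaves like a cube root near \<open>0\<close>.
\<close>

abbreviation flow :: "real \<Rightarrow> real^4 \<Rightarrow> real \<Rightarrow> real^4"
  where "flow a w t \<equiv> w \<cdot>\<^sub>E engel_exp (\<lambda>p. t *\<^sub>R horizontal a p)"

text \<open>This is \<open>2 * q $ 2 * q $ 4 - (q $ 3)\<^sup>2\<close> at
  \<open>q = flow a w t\<close> for \<open>w\<close> in \<open>W\<close>.\<close>

definition entry_poly :: "real \<Rightarrow> real^4 \<Rightarrow> real \<Rightarrow> real"
  where "entry_poly a w t =
    a\<^sup>2 / 12 * t ^ 4 - a * w $ 3 * t\<^sup>2 + 2 * (w $ 4 - w $ 1 * w $ 3) * t - (w $ 3)\<^sup>2"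

text \<open>Multiplying by \<open>2 * q $ 4\<close> is legitimate when \<open>q $ 4 > 0\<close>; for
  \<open>q $ 4 \<le> 0\<close> and \<open>q $ 2 > 0\<close> both sides fail.\<close>

lemma mem_C_iff: "q \<in> C \<longleftrightarrow> q $ 2 > 0 \<and> 2 * q $ 2 * q $ 4 - (q $ 3)\<^sup>2 > 0"
proof (cases "q $ 2 > 0 \<and> q $ 4 > 0")
  case True
  then show ?thesis
    by (simp add: C_def field_simps)
next
  case False
  have "2 * q $ 2 * q $ 4 - (q $ 3)\<^sup>2 \<le> 0" if "q $ 2 > 0" "q $ 4 \<le> 0"
    using mult_nonneg_nonpos[of "q $ 2" "q $ 4"] that zero_le_power2[of "q $ 3"] by linarith
  with False show ?thesis
    by (force simp: C_def)
qed

lemma flow_mem_C_iff: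
  assumes "w \<in> W"
  shows "flow a w t \<in> C \<longleftrightarrow> t > 0 \<and> entry_poly a w t > 0"
proof -
  have "2 * t * (w $ 4 + (w $ 1)\<^sup>2 / 2 * t + a * w $ 1 / 2 * t\<^sup>2 + a\<^sup>2 / 6 * t ^ 3)
      - (w $ 3 + w $ 1 * t + a / 2 * t\<^sup>2)\<^sup>2 = entry_poly a w t"
    unfolding entry_poly_def by (simp add: field_simps power2_eq_square power3_eq_cube power4_eq_xxxx)
  moreover have "w $ 2 = 0"
    using assms by (simp add: W_def)
  ultimately show ?thesis
    by (simp add: mem_C_iff flow_formula)
qed

lemma flow_eq_iff:
  assumes "w \<in> W" "w' \<in> W"
  shows "flow a w t = flow a w' t' \<longleftrightarrow> w = w' \<and> t = t'"
  using assms by (auto simp: W_def flow_formula vec_eq_iff forall_4)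

lemma ex_flow_eq: "\<exists>w\<in>W. \<exists>t. q = flow a w t"
proof -
  \<comment> \<open>\<open>w $ 2 = 0\<close> forces the time to be \<open>q $ 2\<close>; the
    triangular flow formula is then solved coordinate by coordinate.\<close>
  define t where "t = q $ 2"
  define x where "x = q $ 1 - a * t"
  define w where "w = (vector [x, 0, q $ 3 - x * t - a / 2 * t\<^sup>2,
    q $ 4 - x\<^sup>2 / 2 * t - a * x / 2 * t\<^sup>2 - a\<^sup>2 / 6 * t ^ 3] :: real^4)"
  have "w \<in> W" "q = flow a w t"
    by (simp_all add: W_def flow_formula vec_eq_iff forall_4 w_def x_def t_def)
  then show ?thesis by blast
qed

text \<open>The flow lines starting in \<open>W\<close> partition the space, so a set is determined
  by its traces on them.\<close>

lemma eq_intrinsic_upper_graph_iff: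
  "A = intrinsic_upper_graph (horizontal a) T \<longleftrightarrow> (\<forall>w\<in>W. \<forall>t. flow a w t \<in> A \<longleftrightarrow> t > T w)"
proof -
  have mem: "flow a w t \<in> intrinsic_upper_graph (horizontal a) T \<longleftrightarrow> t > T w" if "w \<in> W" for w t
    using that by (auto simp: intrinsic_upper_graph_def flow_eq_iff)
  show ?thesis
  proof
    assume "\<forall>w\<in>W. \<forall>t. flow a w t \<in> A \<longleftrightarrow> t > T w"
    with mem have "q \<in> A \<longleftrightarrow> q \<in> intrinsic_upper_graph (horizontal a) T" for q
      using ex_flow_eq[of q a] by auto
    then show "A = intrinsic_upper_graph (horizontal a) T" by blast
  qed (use mem in simp)
qed

text \<open>\<open>entry_poly a w t / t\<close> is nondecreasing for \<open>t > 0\<close>;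
  cross-multiplying by \<open>s * t\<close> avoids division and differentiation.\<close>

lemma entry_poly_pos_mono:
  assumes "0 < s" "s \<le> t" "entry_poly a w s > 0"
  shows "entry_poly a w t > 0"
proof -
  define y where "y = w $ 3"
  \<comment> \<open>The linear term cancels, \<open>t - s\<close> factors out, and completing the
    square in \<open>y\<close> leaves a nonnegative remainder.\<close>
  have "s * entry_poly a w t - t * entry_poly a w s =
      (t - s) * ((y - a * s * t / 2)\<^sup>2 + a\<^sup>2 / 12 * s * t * (t - s)\<^sup>2)"
    unfolding entry_poly_def y_def
    by (simp add: field_simps power2_eq_square power4_eq_xxxx)
  also have "\<dots> \<ge> 0"
    using assms by simp
  finally have "t * entry_poly a w s \<le> s * entry_poly a w t" by simp
  moreover have "t * entry_poly a w s > 0"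
    using assms by simp
  ultimately show ?thesis
    using assms(1) by (metis less_le_trans zero_less_mult_pos)
qed

lemma ex_entry_poly_pos:
  assumes "a > 0"
  shows "\<exists>t>0. entry_poly a w t > 0"
proof -
  have "filterlim (\<lambda>t. a\<^sup>2 / 12 * t ^ 4 - b * t\<^sup>2 + c * t - d) at_top at_top" for b c d :: real
    using assms by real_asymp
  then have "filterlim (entry_poly a w) at_top at_top"
    unfolding entry_poly_def .
  then have "\<forall>\<^sub>F t in at_top. t > 0 \<and> entry_poly a w t > 0"
    by (simp add: eventually_conj eventually_gt_at_top filterlim_at_top_dense)
  then show ?thesis
    using eventually_happens' trivial_limit_at_top_linorder by blast
qed

text \<open>Openness keeps the infimum out of \<open>S\<close>, and upward closure puts everything
  above it in.\<close>

lemma open_upper_set_real_eq_greaterThan_Inf: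
  fixes S :: "real set"
  assumes "open S" "S \<noteq> {}" "bdd_below S" and up: "\<And>s t. s \<in> S \<Longrightarrow> s \<le> t \<Longrightarrow> t \<in> S"
  shows "S = {Inf S<..}"
proof (intro set_eqI iffI)
  fix t assume t: "t \<in> S"
  then obtain e where "e > 0" "ball t e \<subseteq> S"
    using \<open>open S\<close> openE by blast
  then have "t - e / 2 \<in> S"
    by (auto simp: dist_real_def)
  then have "Inf S \<le> t - e / 2"
    using assms(3) by (rule cInf_lower)
  then show "t \<in> {Inf S<..}"
    using \<open>e > 0\<close> by simp
next
  fix t assume "t \<in> {Inf S<..}"
  then show "t \<in> S"
    using assms(2,3) up by (auto simp: cInf_less_iff intro: less_imp_le)
qed

text \<open>This yields \<open>T\<close> one flow line at a time: \<open>b\<close> will serve as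
  \<open>T w\<close>.\<close>

lemma flow_times_eq_greaterThan:
  assumes "a > 0" "w \<in> W"
  shows "\<exists>b. {t. flow a w t \<in> C} = {b<..}"
proof -
  define S where "S = {t. t > 0 \<and> entry_poly a w t > 0}"
  have "open S"
    unfolding S_def entry_poly_def
    by (intro open_Collect_conj open_Collect_less continuous_intros)
  moreover have "S \<noteq> {}"
    using ex_entry_poly_pos[OF assms(1)] by (auto simp: S_def)
  moreover have "bdd_below S"
    by (rule bdd_belowI[of _ 0]) (simp add: S_def)
  moreover have "t \<in> S" if "s \<in> S" "s \<le> t" for s t
    using that entry_poly_pos_mono by (auto simp: S_def)
  ultimately have "S = {Inf S<..}"
    by (rule open_upper_set_real_eq_greaterThan_Inf)
  then show ?thesis
    using assms(2) by (auto simp: S_def flow_mem_C_iff)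
qed

text \<open>Here \<open>entry_poly\<close> is \<open>a\<^sup>2 / 12 * (t * (t ^ 3 - s ^ 3))\<close>;
  parametrizing the axis by the entry time \<open>s\<close> avoids cube roots.\<close>

lemma graph_function_on_axis:
  assumes "a > 0" "s \<ge> 0" "C = intrinsic_upper_graph (horizontal a) T"
  shows "T (vector [0, 0, 0, - (a\<^sup>2 / 24) * s ^ 3]) = s" (is "T ?w = s")
proof -
  have w: "?w \<in> W"
    by (simp add: W_def)
  have "t > T ?w \<longleftrightarrow> t > s" for t
  proof -
    have "entry_poly a ?w t = a\<^sup>2 / 12 * (t * (t ^ 3 - s ^ 3))"
      by (simp add: entry_poly_def field_simps power3_eq_cube power4_eq_xxxx)
    then have "t > 0 \<and> entry_poly a ?w t > 0 \<longleftrightarrow> t > 0 \<and> s ^ 3 < t ^ 3"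
      using assms(1) by (auto simp only: zero_less_mult_iff) auto
    also have "\<dots> \<longleftrightarrow> t > s"
      using assms(2) by (auto simp: power_strict_mono dest: power_less_imp_less_base)
    finally show ?thesis
      using assms(3) w by (simp add: eq_intrinsic_upper_graph_iff flow_mem_C_iff)
  qed
  then show ?thesis
    by (metis less_irrefl linorder_less_linear)
qed

text \<open>Between parameters \<open>s\<close> and \<open>0\<close> on the axis, \<open>T\<close>
  changes by \<open>s\<close> while the point moves only by a multiple of
  \<open>s ^ 3\<close>.\<close>

lemma graph_function_not_lipschitz:
  assumes "a > 0" "C = intrinsic_upper_graph (horizontal a) T"
  shows "\<not> L-lipschitz_on W T"
proof
  assume lip: "L-lipschitz_on W T"
  define w where "w s = (vector [0, 0, 0, - (a\<^sup>2 / 24) * s ^ 3] :: real^4)" for s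
  have "L \<ge> 0"
    using lip by (rule lipschitz_on_nonneg)
  define K where "K = L * (a\<^sup>2 / 24)"
  \<comment> \<open>Chosen so that \<open>s \<le> 1\<close> and \<open>K * s < 1\<close>, which
    contradicts the bound \<open>1 \<le> K * s * s\<close> forced by the Lipschitz
    condition.\<close>
  define s where "s = 1 / (1 + K)"
  have K: "K \<ge> 0"
    using \<open>L \<ge> 0\<close> by (simp add: K_def)
  then have s: "0 < s" "s \<le> 1" "K * s < 1"
    by (simp_all add: s_def)
  have "dist (w s) (w 0) = a\<^sup>2 / 24 * s ^ 3"
    using s by (simp add: dist_vec_def L2_set_def sum_4 w_def dist_real_def abs_mult)
  moreover have "dist (T (w s)) (T (w 0)) = s"
    using graph_function_on_axis[OF assms(1) _ assms(2), of s]
      graph_function_on_axis[OF assms(1) _ assms(2), of 0] s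
    by (simp add: w_def dist_real_def)
  moreover have "dist (T (w s)) (T (w 0)) \<le> L * dist (w s) (w 0)"
    by (rule lipschitz_onD[OF lip]) (simp_all add: W_def w_def)
  ultimately have "s * 1 \<le> s * (K * s * s)"
    by (simp only: K_def power3_eq_cube mult_1_right mult_ac)
  then have "1 \<le> K * s * s"
    using s by (simp only: mult_le_cancel_left_pos)
  moreover have "K * s * s \<le> K * s"
    using K s by (intro mult_left_le) simp_all
  ultimately show False
    using s by linarith
qed

theorem theorem4p3:
  fixes a :: real
  assumes "a > 0"
  shows "(\<exists>T. C = intrinsic_upper_graph (horizontal a) T) \<and>
    (\<forall>T. C = intrinsic_upper_graph (horizontal a) T \<longrightarrow> \<not> (\<exists>L. L-lipschitz_on W T))"
proof
  \<comment> \<open>Existence ensures that the second conjunct is not vacuous.\<close>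
  have "\<forall>w\<in>W. \<exists>b. {t. flow a w t \<in> C} = {b<..}"
    using flow_times_eq_greaterThan[OF assms] by blast
  then obtain T where "\<forall>w\<in>W. {t. flow a w t \<in> C} = {T w<..}"
    by metis
  then have "C = intrinsic_upper_graph (horizontal a) T"
    unfolding eq_intrinsic_upper_graph_iff by blast
  then show "\<exists>T. C = intrinsic_upper_graph (horizontal a) T"
    by blast
qed (use graph_function_not_lipschitz[OF assms] in blast)

end
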